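(* Let $\alpha>1$, for every $d\in\mathbb{N}$ let $I_d\subseteq\{1,\ldots,d\}$ be given, and let $b_d:=d-\#I_d$. Consider the integration problem $\mathrm{Int}=(\mathrm{Int}_d)_{d\in\mathbb{N}}$ on the sequence of $I_d$-permutation-invariant subspaces $(\mathfrak{S}_{I_d}(E_{d,\alpha}))_{d\in\mathbb{N}}$ in the worst case setting. Then: (1) If the problem is polynomially tractable with the constants $C,p,q$, then $q\ge1$ and $(b_d)_{d\in\mathbb{N}}\in\mathcal{O}(\ln d)$. In particular, the problem is never strongly polynomially tractable. (2) If the problem is uniformly weakly tractable, then $(b_d)_{d\in\mathbb{N}}\in o(d^{\,t})$ for all $t\in(0,1]$. (3) If the problem is $(s,t)$-weakly tractable for some $s,t\in(0,1]$, then $(b_d)_{d\in\mathbb{N}}\in o(d^{\,t})$. In particular, weak tractability implies $(b_d)_{d\in\mathbb{N}}\in o(d)$. (4) If $(b_d)_{d\in\mathbb{N}}\notin o(d)$, then the problem suffers from the curse of dimensionality. In turn, already the absence of the curse implies $(b_d)_{d\in\mathbb{N}}\in o(d)$.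
   Context: Notation: $\mathbb{N}=\{1,2,\ldots\}$, $\mathbb{N}_0=\{0\}\cup\mathbb{N}$, $\#I$ is the cardinality of $I$; $\mathcal{O}$ and $o$ refer to $d\to\infty$. For $f\in L_1([0,1]^d)$ (complex-valued) and $\boldsymbol{k}\in\mathbb{Z}^d$ let $\widehat f(\boldsymbol{k})=\int_{[0,1]^d}f(\boldsymbol{x})e^{-2\pi\mathrm{i}\,\boldsymbol{k}\boldsymbol{x}}\,\mathrm{d}\boldsymbol{x}$, where $\boldsymbol{k}\boldsymbol{x}=\sum_{m=1}^dk_mx_m$. For $k\in\mathbb{Z}$ put $\overline{k}:=\max\{1,|k|\}$. Korobov class: $$E_{d,\alpha}:=\Big\{f\in L_1([0,1]^d):\|f\|:=\sup_{\boldsymbol{k}\in\mathbb{Z}^d}|\widehat f(\boldsymbol{k})|\,(\overline{k_1}\cdots\overline{k_d})^\alpha<\infty\Big\}.$$ Every $f\in E_{d,\alpha}$ has an absolutely convergent Fourier series and is identified with the ($1$-periodic, continuous) function given by it. Permutation-invariance: $\mathcal{S}_{I_d}$ is the set of all bijections $\sigma$ of $\{1,\ldots,d\}$ that fix every element of $\{1,\ldots,d\}\setminus I_d$, acting on vectors by $\sigma(\boldsymbol{x})=(x_{\sigma(1)},\ldots,x_{\sigma(d)})$. $\mathfrak{S}_{I_d}(E_{d,\alpha})$ is the subspace of all $f\in E_{d,\alpha}$ with $f(\boldsymbol{x})=f(\sigma(\boldsymbol{x}))$ for all $\boldsymbol{x}\in[0,1]^d$, $\sigma\in\mathcal{S}_{I_d}$,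 with the norm of $E_{d,\alpha}$. Integration and information complexity: $\mathrm{Int}_d(f)=\int_{[0,1]^d}f(\boldsymbol{x})\,\mathrm{d}\boldsymbol{x}$. A linear cubature rule using at most $N\in\mathbb{N}_0$ function values is $\mathcal{A}_{N,d}(f)=\sum_{n=1}^Nw_nf(\boldsymbol{t}^{(n)})$ with arbitrary $w_n\in\mathbb{C}$, $\boldsymbol{t}^{(n)}\in[0,1]^d$ (zero functional if $N=0$). Put $$e(N,d):=\inf_{\mathcal{A}_{N,d}}\ \sup_{f\in\mathfrak{S}_{I_d}(E_{d,\alpha}),\ \|f\|\le1}|\mathrm{Int}_d(f)-\mathcal{A}_{N,d}(f)|,\qquad n(\epsilon,d):=\min\{N\in\mathbb{N}_0:e(N,d)\le\epsilon\}.$$ Tractability notions. The problem is: - polynomially tractable with the constants $C,p,q$ if $C,p>0$, $q\ge0$ and $n(\epsilon,d)\le C\,\epsilon^{-p}d^{\,q}$ for all $\epsilon\in(0,1]$, $d\in\mathbb{N}$; - strongly polynomially tractable if such an estimate holds with $q=0$ for some $C,p>0$; - $(s,t)$-weakly tractable, for fixed $s,t\in(0,1]$, if $\displaystyle\lim_{\epsilon^{-1}+d\to\infty}\frac{\ln n(\epsilon,d)}{\epsilon^{-s}+d^{\,t}}=0$ (with $\epsilon\in(0,1]$, $d\in\mathbb{N}$, and the convention $\ln0:=0$); - weakly tractable if it is $(1,1)$-weakly tractable; - uniformly weakly tractable if it is $(s,t)$-weakly tractable for all $s,t\in(0,1]$. The problem suffers from the curse of dimensionality if $n(\epsilon,d)$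 grows exponentially in $d$, i.e. there are $c,\epsilon_0,\gamma>0$ such that $n(\epsilon,d)\ge c(1+\gamma)^d$ for all $\epsilon\in(0,\epsilon_0]$ and infinitely many $d\in\mathbb{N}$. *)

theory Defs
  imports "HOL-Analysis.Analysis" "HOL-Library.Landau_Symbols"
begin

section \<open>Korobov classes and their permutation-invariant subspaces\<close>

text \<open>
  The dimension varies inside the statements below, so vectors of length \<open>d\<close> are functions on
  \<open>nat\<close> with coordinates \<open>1, \<dots>, d\<close> (extensional outside of them), and functions on
  the cube are HOL functions whose values outside \<open>cube d\<close> never matter.
\<close>

definition cube :: "nat \<Rightarrow> (nat \<Rightarrow> real) set" where
  "cube d = ({1..d} \<rightarrow>\<^sub>E {0..1})"

definition cube_measure :: "nat \<Rightarrow> (nat \<Rightarrow> real) measure" where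
  "cube_measure d = Pi\<^sub>M {1..d} (\<lambda>_. restrict_space lborel {0..1})"

definition frequencies :: "nat \<Rightarrow> (nat \<Rightarrow> int) set" where
  "frequencies d = ({1..d} \<rightarrow>\<^sub>E UNIV)"

definition dot :: "nat \<Rightarrow> (nat \<Rightarrow> int) \<Rightarrow> (nat \<Rightarrow> real) \<Rightarrow> real" where
  "dot d k x = (\<Sum>m = 1..d. of_int (k m) * x m)"

definition fourier_coeff :: "nat \<Rightarrow> ((nat \<Rightarrow> real) \<Rightarrow> complex) \<Rightarrow> (nat \<Rightarrow> int) \<Rightarrow> complex" where
  "fourier_coeff d f k =
     (LINT x|cube_measure d. f x * exp (- 2 * of_real pi * \<i> * of_real (dot d k x)))"

definition korobov_norm :: "nat \<Rightarrow> real \<Rightarrow> ((nat \<Rightarrow> real) \<Rightarrow> complex) \<Rightarrow> ennreal" where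
  "korobov_norm d \<alpha> f =
     (SUP k\<in>frequencies d.
        ennreal (norm (fourier_coeff d f k) * (\<Prod>m = 1..d. max 1 \<bar>real_of_int (k m)\<bar>) powr \<alpha>))"

text \<open>
  The last condition selects, from each class of almost everywhere equal functions, the
  representative given pointwise by the Fourier series. A series of complex numbers
  \<open>has_sum\<close> exactly if it converges absolutely. As the representative is continuous, Borel
  measurability (which is what \<^const>\<open>integrable\<close> demands here) costs no generality over
  Lebesgue measurability.
\<close>

definition korobov :: "nat \<Rightarrow> real \<Rightarrow> ((nat \<Rightarrow> real) \<Rightarrow> complex) set" where
  "korobov d \<alpha> =
     {f. integrable (cube_measure d) f \<and> korobov_norm d \<alpha> f < \<infinity> \<and>
         (\<forall>x\<in>cube d.
            ((\<lambda>k. fourier_coeff d f k * exp (2 * of_real pi * \<i> * of_real (dot d k x)))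
               has_sum f x) (frequencies d))}"

definition perms_on :: "nat \<Rightarrow> nat set \<Rightarrow> (nat \<Rightarrow> nat) set" where
  "perms_on d I = {\<sigma>. bij_betw \<sigma> {1..d} {1..d} \<and> (\<forall>j\<in>{1..d} - I. \<sigma> j = j)}"

definition perm_inv_korobov :: "nat \<Rightarrow> nat set \<Rightarrow> real \<Rightarrow> ((nat \<Rightarrow> real) \<Rightarrow> complex) set" where
  "perm_inv_korobov d I \<alpha> =
     {f \<in> korobov d \<alpha>. \<forall>\<sigma>\<in>perms_on d I. \<forall>x\<in>cube d. f x = f (\<lambda>m\<in>{1..d}. x (\<sigma> m))}"

section \<open>Worst case error and information complexity\<close>

definition Int_cube :: "nat \<Rightarrow> ((nat \<Rightarrow> real) \<Rightarrow> complex) \<Rightarrow> complex" where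
  "Int_cube d f = (LINT x|cube_measure d. f x)"

definition cubature_rules :: "nat \<Rightarrow> nat \<Rightarrow> (((nat \<Rightarrow> real) \<Rightarrow> complex) \<Rightarrow> complex) set" where
  "cubature_rules N d =
     {A. \<exists>(w :: nat \<Rightarrow> complex) t. t \<in> {1..N} \<rightarrow> cube d \<and> A = (\<lambda>f. \<Sum>n = 1..N. w n * f (t n))}"

definition min_error :: "real \<Rightarrow> (nat \<Rightarrow> nat set) \<Rightarrow> nat \<Rightarrow> nat \<Rightarrow> ennreal" where
  "min_error \<alpha> I N d =
     (INF A\<in>cubature_rules N d.
        SUP f\<in>{f \<in> perm_inv_korobov d (I d) \<alpha>. korobov_norm d \<alpha> f \<le> 1}.
          ennreal (norm (Int_cube d f - A f)))"

definition info_complexity :: "real \<Rightarrow> (nat \<Rightarrow> nat set) \<Rightarrow> real \<Rightarrow> nat \<Rightarrow> nat" where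
  "info_complexity \<alpha> I \<epsilon> d = (LEAST N. min_error \<alpha> I N d \<le> ennreal \<epsilon>)"

section \<open>Tractability\<close>

text \<open>Here \<open>n \<epsilon> d\<close> is the information complexity of a sequence of problems.\<close>

definition polynomially_tractable_with ::
    "(real \<Rightarrow> nat \<Rightarrow> nat) \<Rightarrow> real \<Rightarrow> real \<Rightarrow> real \<Rightarrow> bool" where
  "polynomially_tractable_with n C p q \<longleftrightarrow>
     C > 0 \<and> p > 0 \<and> q \<ge> 0 \<and>
     (\<forall>\<epsilon>\<in>{0<..1}. \<forall>d\<ge>1. real (n \<epsilon> d) \<le> C * \<epsilon> powr (- p) * real d powr q)"

definition strongly_polynomially_tractable :: "(real \<Rightarrow> nat \<Rightarrow> nat) \<Rightarrow> bool" where
  "strongly_polynomially_tractable n \<longleftrightarrow> (\<exists>C p. polynomially_tractable_with n C p 0)"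

definition inv_eps_plus_dim_at_top :: "(real \<times> nat) filter" where
  "inv_eps_plus_dim_at_top =
     inf (filtercomap (\<lambda>(\<epsilon>, d). 1 / \<epsilon> + real d) at_top) (principal ({0<..1} \<times> {1..}))"

text \<open>Note that \<^term>\<open>ln (0::real) = 0\<close> in HOL, by the lemma below.\<close>

lemma ln_zero_convention: "ln (0::real) = 0"
  by simp

definition weakly_tractable_st :: "real \<Rightarrow> real \<Rightarrow> (real \<Rightarrow> nat \<Rightarrow> nat) \<Rightarrow> bool" where
  "weakly_tractable_st s t n \<longleftrightarrow>
     ((\<lambda>(\<epsilon>, d). ln (real (n \<epsilon> d)) / (\<epsilon> powr (- s) + real d powr t)) \<longlongrightarrow> 0)
       inv_eps_plus_dim_at_top"

definition weakly_tractable :: "(real \<Rightarrow> nat \<Rightarrow> nat) \<Rightarrow> bool" where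
  "weakly_tractable n \<longleftrightarrow> weakly_tractable_st 1 1 n"

definition uniformly_weakly_tractable :: "(real \<Rightarrow> nat \<Rightarrow> nat) \<Rightarrow> bool" where
  "uniformly_weakly_tractable n \<longleftrightarrow>
     (\<forall>s\<in>{0<..1}. \<forall>t\<in>{0<..1}. weakly_tractable_st s t n)"

definition curse_of_dimensionality :: "(real \<Rightarrow> nat \<Rightarrow> nat) \<Rightarrow> bool" where
  "curse_of_dimensionality n \<longleftrightarrow>
     (\<exists>c>0. \<exists>\<epsilon>\<^sub>0>0. \<exists>\<gamma>>0.
        infinite {d. d \<ge> 1 \<and> (\<forall>\<epsilon>\<in>{0<..\<epsilon>\<^sub>0}. real (n \<epsilon> d) \<ge> c * (1 + \<gamma>) ^ d)})"

end

theory Submission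
  imports Defs "HOL-Probability.Infinite_Product_Measure"
begin

text \<open>
  Everything follows from one lower bound: for \<open>\<epsilon> < 1\<close> the information complexity in dimension
  \<open>d\<close> is at least \<open>2\<^sup>b (a + 1)\<close>, where \<open>a\<close> is the number of coordinates in \<open>I d\<close> and
  \<open>b = d - a\<close> (\<open>info_complexity_lower_bound\<close>). This number is at least \<open>2\<^sup>b\<close>, so any upper
  bound on the complexity at \<open>\<epsilon> = 1/2\<close> limits the growth of \<open>b\<close>; it is also at least \<open>d + 1\<close>,
  so no such bound can be sublinear in \<open>d\<close>.

  The bound holds because fewer than \<open>2\<^sup>b (a + 1)\<close> function values cannot tell every function
  with integral \<open>1\<close> in the unit ball from the zero function.
  The frequencies in \<open>{0,1}\<^sup>d\<close> form \<open>2\<^sup>b (a + 1)\<close> orbits under the permutations of \<open>I d\<close>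
  (\<open>card_orbit_types\<close>), so some nonzero invariant trigonometric polynomial with these frequencies
  vanishes at all nodes (\<open>underdetermined_system_nontrivial_solution\<close>). Multiplied by suitably
  averaged conjugate characters it becomes an invariant function in the unit ball with
  integral \<open>1\<close> that still vanishes at the nodes (\<open>fooling_function\<close>). Every rule with these
  nodes therefore has worst case error at least \<open>1\<close>.

  The information complexity is defined as a least number, so a lower bound on it also requires
  that some rule achieves the error \<open>\<epsilon>\<close>. For \<open>\<alpha> > 1\<close> the Korobov weights are summable, and
  hence the arithmetic means over sufficiently fine grids converge to the integral uniformly on
  the unit ball (\<open>exists_cubature_rule_with_small_error\<close>).
\<close>


section \<open>Characters and trigonometric polynomials\<close>

definition fourier_char :: "nat \<Rightarrow> (nat \<Rightarrow> int) \<Rightarrow> (nat \<Rightarrow> real) \<Rightarrow> complex" where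
  "fourier_char d k x = exp (2 * of_real pi * \<i> * of_real (dot d k x))"

lemma fourier_char_conv_prod:
  "fourier_char d k x = (\<Prod>j\<in>{1..d}. exp (2 * of_real pi * \<i> * of_int (k j) * of_real (x j)))"
  by (simp add: fourier_char_def dot_def sum_distrib_left mult.assoc flip: exp_sum)

lemma norm_fourier_char [simp]: "norm (fourier_char d k x) = 1"
  by (simp add: fourier_char_def)

lemma fourier_char_diff:
  "fourier_char d (\<lambda>j\<in>{1..d}. k j - l j) x = fourier_char d k x * fourier_char d (\<lambda>j. - l j) x"
  unfolding fourier_char_def
  by (simp add: dot_def sum_subtractf sum_negf algebra_simps flip: exp_add)

lemma fourier_coeff_conv_char:
  "fourier_coeff d f k = (LINT x|cube_measure d. f x * fourier_char d (\<lambda>j. - k j) x)"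
  by (simp add: fourier_coeff_def fourier_char_def dot_def sum_negf)

lemma Int_cube_eq_fourier_coeff: "Int_cube d f = fourier_coeff d f (\<lambda>j\<in>{1..d}. 0)"
  by (simp add: Int_cube_def fourier_coeff_def dot_def)

abbreviation unit_interval_measure :: "real measure" where
  "unit_interval_measure \<equiv> restrict_space lborel {0..1}"

lemma prob_space_unit_interval: "prob_space unit_interval_measure"
  by (rule prob_spaceI) (simp add: emeasure_restrict_space space_restrict_space)

lemma integral_exp_unit_interval:
  "(LINT x|unit_interval_measure. exp (2 * of_real pi * \<i> * of_int n * of_real x)) =
     (if n = 0 then 1 else 0 :: complex)"
proof (cases "n = 0")
  case True
  interpret prob_space unit_interval_measure by (rule prob_space_unit_interval)
  show ?thesis using True by (simp add: measure_restrict_space)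
next
  case False
  define c where "c = 2 * of_real pi * \<i> * (of_int n :: complex)"
  have c: "c \<noteq> 0" using False by (simp add: c_def)
  have "(LINT x|unit_interval_measure. exp (c * of_real x)) =
          (LINT x|lborel. indicator {0..1} x *\<^sub>R exp (c * of_real x))"
    by (rule integral_restrict_space) simp
  also have "\<dots> = exp (c * of_real 1) / c - exp (c * of_real 0) / c"
  proof (rule integral_FTC_Icc)
    show "continuous_on {0..1} (\<lambda>x. exp (c * complex_of_real x))"
      by (intro continuous_intros)
    show "((\<lambda>x. exp (c * complex_of_real x) / c) has_vector_derivative exp (c * of_real x))
            (at x within {0..1})" for x
      by (rule has_vector_derivative_real_field[of "\<lambda>z. exp (c * z) / c"])
         (use c in \<open>auto intro!: derivative_eq_intros\<close>)
  qed simp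
  also have "exp (c * of_real 1) = 1"
    by (simp add: c_def exp_eq_1)
  finally show ?thesis using False by (simp add: c_def)
qed

lemma cube_measure_eq: "cube_measure d = Pi\<^sub>M {1..d} (\<lambda>_. unit_interval_measure)"
  by (simp add: cube_measure_def)

lemma prob_space_cube_measure: "prob_space (cube_measure d)"
  unfolding cube_measure_eq by (intro prob_space_PiM prob_space_unit_interval)

lemma borel_measurable_fourier_char [measurable]:
  "fourier_char d k \<in> borel_measurable (cube_measure d)"
proof -
  have "(\<lambda>x. x j) \<in> borel_measurable (cube_measure d)" if "j \<in> {1..d}" for j
    unfolding cube_measure_eq using that
    by (intro measurable_compose[OF measurable_component_singleton] measurable_restrict_space1) auto
  hence "(\<lambda>x. dot d k x) \<in> borel_measurable (cube_measure d)"
    unfolding dot_def by (intro borel_measurable_sum borel_measurable_times) auto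
  thus ?thesis unfolding fourier_char_def by measurable
qed

lemma integrable_fourier_char [simp]: "integrable (cube_measure d) (fourier_char d k)"
proof -
  interpret prob_space "cube_measure d" by (rule prob_space_cube_measure)
  show ?thesis by (rule integrable_const_bound[where B = 1]) auto
qed

lemma integral_fourier_char:
  "(LINT x|cube_measure d. fourier_char d k x) = (if \<forall>j\<in>{1..d}. k j = 0 then 1 else 0)"
proof -
  interpret U: prob_space unit_interval_measure by (rule prob_space_unit_interval)
  interpret product_sigma_finite "\<lambda>_ :: nat. unit_interval_measure" by standard
  have "integrable unit_interval_measure (\<lambda>x. exp (2 * of_real pi * \<i> * of_int (k j) * of_real x))" for j
    by (rule U.integrable_const_bound[where B = 1]) (auto intro!: measurable_restrict_space1)
  hence "(LINT x|cube_measure d. fourier_char d k x) =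
    (\<Prod>j\<in>{1..d}. LINT x|unit_interval_measure. exp (2 * of_real pi * \<i> * of_int (k j) * of_real x))"
    unfolding fourier_char_conv_prod cube_measure_eq
    by (intro product_integral_prod) auto
  thus ?thesis by (auto simp: integral_exp_unit_interval)
qed

text \<open>
  Orthogonality of the characters reads off the coefficients. The frequencies \<open>g p\<close> may
  repeat, so the polynomial may be written as an unexpanded product of two sums.
\<close>

lemma fourier_coeff_trig_poly:
  assumes "finite P" "g ` P \<subseteq> frequencies d" "k \<in> frequencies d"
  shows "fourier_coeff d (\<lambda>x. \<Sum>p\<in>P. c p * fourier_char d (g p) x) k = (\<Sum>p | p \<in> P \<and> g p = k. c p)"
proof -
  have "fourier_coeff d (\<lambda>x. \<Sum>p\<in>P. c p * fourier_char d (g p) x) k =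
      (LINT x|cube_measure d. (\<Sum>p\<in>P. c p * fourier_char d (\<lambda>j\<in>{1..d}. g p j - k j) x))"
    by (simp add: fourier_coeff_conv_char fourier_char_diff sum_distrib_right mult.assoc
          del: One_nat_def)
  also have "\<dots> = (\<Sum>p\<in>P. c p * (if \<forall>j\<in>{1..d}. g p j - k j = 0 then 1 else 0))"
    by (subst Bochner_Integration.integral_sum) (auto simp: integral_fourier_char)
  also have "\<dots> = (\<Sum>p\<in>P. if g p = k then c p else 0)"
  proof (intro sum.cong refl)
    fix p assume "p \<in> P"
    hence "g p \<in> frequencies d" using assms by blast
    hence "g p = k \<longleftrightarrow> (\<forall>j\<in>{1..d}. g p j = k j)"
      using PiE_ext[of "g p" "{1..d}" "\<lambda>_. UNIV" k] assms(3) unfolding frequencies_def by blast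
    thus "c p * (if \<forall>j\<in>{1..d}. g p j - k j = 0 then 1 else 0) = (if g p = k then c p else 0)"
      by auto
  qed
  finally show ?thesis using assms(1) by (simp add: sum.inter_filter)
qed

lemma trig_poly_has_sum:
  fixes c :: "'p \<Rightarrow> complex" and g :: "'p \<Rightarrow> nat \<Rightarrow> int"
  assumes P: "finite P" "g ` P \<subseteq> frequencies d"
  defines "f \<equiv> \<lambda>x. \<Sum>p\<in>P. c p * fourier_char d (g p) x"
  shows "((\<lambda>k. fourier_coeff d f k * fourier_char d k x) has_sum f x) (frequencies d)"
proof (rule has_sum_finite_neutralI[of "g ` P"])
  show "fourier_coeff d f k * fourier_char d k x = 0" if k: "k \<in> frequencies d - g ` P" for k
  proof -
    have none: "{p \<in> P. g p = k} = {}" using k by auto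
    have "fourier_coeff d f k = 0"
      unfolding f_def fourier_coeff_trig_poly[OF P DiffD1[OF k]] none by simp
    thus ?thesis by simp
  qed
  have "f x = (\<Sum>k\<in>g ` P. \<Sum>p | p \<in> P \<and> g p = k. c p * fourier_char d (g p) x)"
    unfolding f_def using assms by (intro sum.image_gen)
  also have "\<dots> = (\<Sum>k\<in>g ` P. fourier_coeff d f k * fourier_char d k x)"
  proof (rule sum.cong[OF refl])
    fix k assume "k \<in> g ` P"
    hence k: "k \<in> frequencies d" using P by blast
    have "fourier_coeff d f k = (\<Sum>p | p \<in> P \<and> g p = k. c p)"
      unfolding f_def by (rule fourier_coeff_trig_poly[OF P k])
    thus "(\<Sum>p | p \<in> P \<and> g p = k. c p * fourier_char d (g p) x) =
            fourier_coeff d f k * fourier_char d k x"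
      by (simp add: sum_distrib_right)
  qed
  finally show "f x = (\<Sum>k\<in>g ` P. fourier_coeff d f k * fourier_char d k x)" .
qed (use assms in auto)

lemma trig_poly_in_korobov:
  fixes c :: "'p \<Rightarrow> complex" and g :: "'p \<Rightarrow> nat \<Rightarrow> int"
  assumes P: "finite P" "g ` P \<subseteq> frequencies d"
  defines "f \<equiv> \<lambda>x. \<Sum>p\<in>P. c p * fourier_char d (g p) x"
  assumes le: "\<And>k. k \<in> frequencies d \<Longrightarrow>
     norm (fourier_coeff d f k) * (\<Prod>m = 1..d. max 1 \<bar>real_of_int (k m)\<bar>) powr \<alpha> \<le> 1"
  shows "f \<in> korobov d \<alpha>" "korobov_norm d \<alpha> f \<le> 1"
proof -
  show norm: "korobov_norm d \<alpha> f \<le> 1"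
    unfolding korobov_norm_def using le by (auto intro!: SUP_least)
  have "integrable (cube_measure d) f"
    unfolding f_def by auto
  moreover have "korobov_norm d \<alpha> f < \<infinity>"
    using norm by (rule order.strict_trans1) simp
  ultimately show "f \<in> korobov d \<alpha>"
    using trig_poly_has_sum[OF P, of c]
    by (simp add: korobov_def f_def fourier_char_def)
qed


section \<open>Linear systems with more unknowns than equations\<close>

text \<open>
  Gaussian elimination of one unknown \<open>p\<close> per equation; the number of unknowns exceeds the
  number of equations throughout.
\<close>

lemma underdetermined_system_nontrivial_solution:
  fixes a :: "nat \<Rightarrow> 'j \<Rightarrow> 'a :: field"
  assumes "finite J" "N < card J"
  shows "\<exists>c. (\<exists>j\<in>J. c j \<noteq> 0) \<and> (\<forall>n\<in>{1..N}. (\<Sum>j\<in>J. a n j * c j) = 0)"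
  using assms
proof (induction N arbitrary: J a)
  case 0
  then obtain j where "j \<in> J" by fastforce
  thus ?case by (intro exI[of _ "\<lambda>_. 1"]) auto
next
  case (Suc N)
  show ?case
  proof (cases "\<forall>j\<in>J. a (Suc N) j = 0")
    case True
    from Suc.IH[OF Suc.prems(1), of a] Suc.prems(2)
    obtain c where c: "\<exists>j\<in>J. c j \<noteq> 0" "\<forall>n\<in>{1..N}. (\<Sum>j\<in>J. a n j * c j) = 0" by auto
    show ?thesis using c True by (intro exI[of _ c]) (auto simp: le_Suc_eq)
  next
    case False
    then obtain p where p: "p \<in> J" "a (Suc N) p \<noteq> 0" by blast
    define a' where "a' = (\<lambda>n j. a n j - a n p * a (Suc N) j / a (Suc N) p)"
    have "N < card (J - {p})" using Suc.prems p by simp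
    from Suc.IH[OF _ this, of a'] Suc.prems(1)
    obtain c where c: "\<exists>j\<in>J - {p}. c j \<noteq> 0" "\<forall>n\<in>{1..N}. (\<Sum>j\<in>J - {p}. a' n j * c j) = 0"
      by auto
    define s where "s = (\<Sum>j\<in>J - {p}. a (Suc N) j * c j)"
    \<comment> \<open>the pivot coordinate solves the last equation for the eliminated unknown\<close>
    define c' where "c' = c(p := - s / a (Suc N) p)"
    have split: "(\<Sum>j\<in>J. a n j * c' j) = (\<Sum>j\<in>J - {p}. a n j * c j) - a n p * s / a (Suc N) p" for n
    proof -
      have "(\<Sum>j\<in>J. a n j * c' j) = a n p * c' p + (\<Sum>j\<in>J - {p}. a n j * c' j)"
        using Suc.prems(1) p by (simp add: sum.remove)
      also have "(\<Sum>j\<in>J - {p}. a n j * c' j) = (\<Sum>j\<in>J - {p}. a n j * c j)"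
        by (intro sum.cong) (auto simp: c'_def)
      finally show ?thesis by (simp add: c'_def)
    qed
    have "(\<Sum>j\<in>J. a n j * c' j) = 0" if n: "n \<in> {1..Suc N}" for n
    proof (cases "n = Suc N")
      case True
      thus ?thesis using p by (simp add: split s_def)
    next
      case False
      hence "(\<Sum>j\<in>J - {p}. a' n j * c j) = 0" using c n by auto
      moreover have "(\<Sum>j\<in>J - {p}. a' n j * c j) =
                       (\<Sum>j\<in>J - {p}. a n j * c j) - a n p * s / a (Suc N) p"
        by (simp add: a'_def s_def left_diff_distrib sum_subtractf sum_distrib_left
              sum_divide_distrib mult.assoc)
      ultimately show ?thesis by (simp add: split)
    qed
    moreover have "\<exists>j\<in>J. c' j \<noteq> 0" using c by (auto simp: c'_def)
    ultimately show ?thesis by blast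
  qed
qed


section \<open>Orbits of the frequencies in a cube\<close>

definition freq_of_set :: "nat \<Rightarrow> nat set \<Rightarrow> nat \<Rightarrow> int" where
  "freq_of_set d S = (\<lambda>j\<in>{1..d}. of_bool (j \<in> S))"

text \<open>
  Two subsets of \<open>{1..d}\<close> lie in the same orbit under the permutations of \<open>I\<close> exactly if
  they agree outside \<open>I\<close> and have equally many elements in \<open>I\<close>. Hence this pair is a complete
  invariant of the orbit, and coefficients that depend on it alone are the invariant ones.
\<close>

definition orbit_type :: "nat set \<Rightarrow> nat set \<Rightarrow> nat set \<times> nat" where
  "orbit_type I S = (S - I, card (S \<inter> I))"

text \<open>
  This is the number of linearly independent invariant trigonometric polynomials with frequencies
  in \<open>{0,1}\<^sup>d\<close>, and so the number of function values below which one of them escapes detection.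
\<close>

lemma card_orbit_types:
  assumes "I \<subseteq> {1..d}"
  shows "card (orbit_type I ` Pow {1..d}) = 2 ^ (d - card I) * (card I + 1)"
proof -
  have fin: "finite I" using assms by (rule finite_subset) simp
  have "orbit_type I ` Pow {1..d} = Pow ({1..d} - I) \<times> {..card I}"
  proof
    show "orbit_type I ` Pow {1..d} \<subseteq> Pow ({1..d} - I) \<times> {..card I}"
      using fin by (auto simp: orbit_type_def intro!: card_mono)
    show "Pow ({1..d} - I) \<times> {..card I} \<subseteq> orbit_type I ` Pow {1..d}"
    proof
      fix p assume "p \<in> Pow ({1..d} - I) \<times> {..card I}"
      then obtain A m where p: "p = (A, m)" "A \<subseteq> {1..d} - I" "m \<le> card I" by auto
      obtain B where B: "B \<subseteq> I" "card B = m" using obtain_subset_with_card_n[OF p(3)] by metis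
      have "(A \<union> B) - I = A" "(A \<union> B) \<inter> I = B" using p B by auto
      hence "p = orbit_type I (A \<union> B)" using B p by (simp add: orbit_type_def)
      moreover have "A \<union> B \<in> Pow {1..d}" using p B assms by blast
      ultimately show "p \<in> orbit_type I ` Pow {1..d}" by (rule image_eqI)
    qed
  qed
  moreover have "card ({1..d} - I) = d - card I"
    using assms fin by (simp add: card_Diff_subset)
  ultimately show ?thesis by (simp add: card_cartesian_product card_Pow)
qed

lemma perms_on_image_Pow:
  assumes \<sigma>: "\<sigma> \<in> perms_on d I"
  shows "bij_betw (image \<sigma>) (Pow {1..d}) (Pow {1..d})"
  using \<sigma> by (simp add: perms_on_def bij_betw_Pow)

lemma orbit_type_image:
  assumes \<sigma>: "\<sigma> \<in> perms_on d I" and I: "I \<subseteq> {1..d}" and S: "S \<subseteq> {1..d}"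
  shows "orbit_type I (\<sigma> ` S) = orbit_type I S"
proof -
  have inj: "inj_on \<sigma> {1..d}" and onto: "\<sigma> ` {1..d} = {1..d}"
    and fix_out: "\<And>j. j \<in> {1..d} - I \<Longrightarrow> \<sigma> j = j"
    using \<sigma> by (auto simp: perms_on_def bij_betw_def)
  have stays: "\<sigma> j \<in> I" if "j \<in> I" for j
  proof (rule ccontr)
    assume "\<sigma> j \<notin> I"
    moreover have "\<sigma> j \<in> {1..d}" using that I onto by blast
    ultimately have "\<sigma> (\<sigma> j) = \<sigma> j" "\<sigma> j \<in> {1..d}" using fix_out by auto
    hence "\<sigma> j = j" using inj_onD[OF inj, of "\<sigma> j" j] that I by blast
    thus False using that \<open>\<sigma> j \<notin> I\<close> by simp
  qed
  have "\<sigma> ` S = (S - I) \<union> \<sigma> ` (S \<inter> I)"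
  proof -
    have "\<sigma> ` (S - I) = S - I" using fix_out S by (intro image_cong[THEN trans, OF refl _ image_ident]) auto
    thus ?thesis by (metis Int_Diff_Un Un_commute image_Un)
  qed
  hence "\<sigma> ` S - I = S - I" "\<sigma> ` S \<inter> I = \<sigma> ` (S \<inter> I)"
    using stays by auto
  moreover have "card (\<sigma> ` (S \<inter> I)) = card (S \<inter> I)"
    by (intro card_image inj_on_subset[OF inj]) (use S in blast)
  ultimately show ?thesis by (simp add: orbit_type_def)
qed

lemma dot_freq_of_set:
  assumes "S \<subseteq> {1..d}"
  shows "dot d (freq_of_set d S) x = (\<Sum>j\<in>S. x j)"
proof -
  have "dot d (freq_of_set d S) x = (\<Sum>j\<in>{1..d}. if j \<in> S then x j else 0)"
    unfolding dot_def freq_of_set_def by (intro sum.cong) auto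
  also have "\<dots> = (\<Sum>j\<in>S. x j)" using assms by (simp add: sum.If_cases Int_absorb1)
  finally show ?thesis .
qed

lemma dot_freq_of_set_permuted:
  assumes \<sigma>: "\<sigma> \<in> perms_on d I" and S: "S \<subseteq> {1..d}"
  shows "dot d (freq_of_set d S) (\<lambda>m\<in>{1..d}. x (\<sigma> m)) = dot d (freq_of_set d (\<sigma> ` S)) x"
proof -
  have \<sigma>: "inj_on \<sigma> {1..d}" "\<sigma> ` {1..d} = {1..d}"
    using \<sigma> by (simp_all add: perms_on_def bij_betw_def)
  hence "\<sigma> ` S \<subseteq> {1..d}" "inj_on \<sigma> S"
    using S inj_on_subset by blast+
  moreover have "(\<Sum>j\<in>S. (\<lambda>m\<in>{1..d}. x (\<sigma> m)) j) = (\<Sum>j\<in>S. x (\<sigma> j))"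
    using S by (intro sum.cong) auto
  ultimately show ?thesis using S by (simp add: dot_freq_of_set sum.reindex o_def)
qed

text \<open>
  Permuting the coordinates of \<open>x\<close> only permutes the subsets \<open>S\<close> inside their orbits. The free
  parameter \<open>h\<close> covers the character of \<open>S\<close> as well as its complex conjugate.
\<close>

lemma sum_over_types_perm_invariant:
  fixes c :: "nat set \<times> nat \<Rightarrow> complex" and h :: "real \<Rightarrow> complex"
  assumes \<sigma>: "\<sigma> \<in> perms_on d I" and I: "I \<subseteq> {1..d}"
  shows "(\<Sum>S\<in>Pow {1..d}. c (orbit_type I S) * h (dot d (freq_of_set d S) (\<lambda>m\<in>{1..d}. x (\<sigma> m)))) =
         (\<Sum>S\<in>Pow {1..d}. c (orbit_type I S) * h (dot d (freq_of_set d S) x))"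
proof -
  have "(\<Sum>S\<in>Pow {1..d}. c (orbit_type I S) * h (dot d (freq_of_set d S) (\<lambda>m\<in>{1..d}. x (\<sigma> m)))) =
        (\<Sum>S\<in>Pow {1..d}. c (orbit_type I (\<sigma> ` S)) * h (dot d (freq_of_set d (\<sigma> ` S)) x))"
    using orbit_type_image[OF \<sigma> I] dot_freq_of_set_permuted[OF \<sigma>] by (intro sum.cong) auto
  also have "\<dots> = (\<Sum>S\<in>Pow {1..d}. c (orbit_type I S) * h (dot d (freq_of_set d S) x))"
    by (rule sum.reindex_bij_betw[OF perms_on_image_Pow[OF \<sigma>]])
  finally show ?thesis .
qed


section \<open>Functions that vanish at the nodes\<close>

lemma freq_of_set_inject:
  assumes "S \<subseteq> {1..d}" "L \<subseteq> {1..d}" "\<And>j. j \<in> {1..d} \<Longrightarrow> freq_of_set d S j = freq_of_set d L j"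
  shows "S = L"
proof (rule set_eqI)
  fix j show "j \<in> S \<longleftrightarrow> j \<in> L"
    using assms(1,2) assms(3)[of j] by (cases "j \<in> {1..d}") (auto simp: freq_of_set_def)
qed

text \<open>
  Let \<open>T\<close> be a nonzero invariant polynomial with frequencies in \<open>{0,1}\<^sup>d\<close> that vanishes at the
  nodes, scaled so that its largest coefficient equals \<open>1\<close> and is attained at \<open>S0\<close>. Multiplying
  \<open>T\<close> by the conjugate character of \<open>S0\<close> would move this coefficient to the frequency
  \<open>0\<close>, that is, give a function with integral \<open>1\<close> and the same zeros, but would destroy the
  invariance. Multiplying by the mean \<open>D\<close> of the conjugate characters over the orbit of \<open>S0\<close>
  keeps both: all coefficients of \<open>T\<close> on that orbit equal \<open>1\<close>. A coefficient of the product
  is an average of coefficients of \<open>T\<close>, hence at most \<open>1\<close> in modulus, and it sits at a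
  frequency in \<open>{-1,0,1}\<^sup>d\<close>, where the Korobov weight is \<open>1\<close>. So the norm is at most \<open>1\<close>.
\<close>

lemma fooling_function:
  assumes I: "I \<subseteq> {1..d}" and N: "N < 2 ^ (d - card I) * (card I + 1)"
  shows "\<exists>f\<in>perm_inv_korobov d I \<alpha>. korobov_norm d \<alpha> f \<le> 1 \<and> Int_cube d f = 1 \<and>
           (\<forall>n\<in>{1..N}. f (t n) = 0)"
proof -
  let ?P = "Pow {1..d}" and ?e = "\<lambda>S. fourier_char d (freq_of_set d S)"
  let ?ty = "orbit_type I"
  obtain c where c_nz: "\<exists>j\<in>?ty ` ?P. c j \<noteq> 0"
    and c_sol: "\<forall>n\<in>{1..N}. (\<Sum>j\<in>?ty ` ?P. (\<Sum>S | S \<in> ?P \<and> ?ty S = j. ?e S (t n)) * c j) = 0"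
    using underdetermined_system_nontrivial_solution[of "?ty ` ?P" N
        "\<lambda>n j. \<Sum>S | S \<in> ?P \<and> ?ty S = j. ?e S (t n)"] N card_orbit_types[OF I] by auto
  define M where "M = Max ((\<lambda>S. norm (c (?ty S))) ` ?P)"
  have "M \<in> (\<lambda>S. norm (c (?ty S))) ` ?P"
    unfolding M_def by (rule Max_in) auto
  then obtain S0 where S0: "S0 \<in> ?P" "M = norm (c (?ty S0))" by blast
  have le_M: "norm (c (?ty S)) \<le> M" if "S \<in> ?P" for S
    unfolding M_def using that by (intro Max_ge) auto
  have "M > 0"
  proof -
    obtain S where "S \<in> ?P" "c (?ty S) \<noteq> 0" using c_nz by blast
    thus ?thesis using le_M[of S] by (smt (verit) zero_less_norm_iff)
  qed
  define a where "a = (\<lambda>j. c j / c (?ty S0))"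
  have a_le: "norm (a (?ty S)) \<le> 1" if "S \<in> ?P" for S
    using le_M[OF that] S0 \<open>M > 0\<close> by (simp add: a_def norm_divide)
  define Orb where "Orb = {L \<in> ?P. ?ty L = ?ty S0}"
  have Orb: "finite Orb" "Orb \<noteq> {}"
    using S0 by (auto simp: Orb_def)
  \<comment> \<open>uniform distribution on the orbit of \<open>S0\<close>, as a function of the orbit type\<close>
  define u where "u = (\<lambda>j. of_bool (j = ?ty S0) / of_nat (card Orb) :: complex)"
  have sum_u: "(\<Sum>L\<in>?P. g (u (?ty L)) (?ty L)) = of_nat (card Orb) * g (1 / of_nat (card Orb)) (?ty S0)"
    if "\<And>j. g 0 j = 0" for g :: "complex \<Rightarrow> nat set \<times> nat \<Rightarrow> 'b :: semiring_1"
  proof -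
    have "(\<Sum>L\<in>?P. g (u (?ty L)) (?ty L)) = (\<Sum>L\<in>Orb. g (u (?ty L)) (?ty L))"
      using that by (intro sum.mono_neutral_right) (auto simp: Orb_def u_def)
    also have "\<dots> = (\<Sum>L\<in>Orb. g (1 / of_nat (card Orb)) (?ty S0))"
      by (intro sum.cong) (auto simp: Orb_def u_def)
    finally show ?thesis by simp
  qed
  define T where "T = (\<lambda>x. \<Sum>S\<in>?P. a (?ty S) * ?e S x)"
  define D where "D = (\<lambda>x. \<Sum>L\<in>?P. u (?ty L) * fourier_char d (\<lambda>j. - freq_of_set d L j) x)"
  define co where "co = (\<lambda>(L, S). u (?ty L) * a (?ty S))"
  define g where "g = (\<lambda>(L, S). \<lambda>j\<in>{1..d}. freq_of_set d S j - freq_of_set d L j)"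
  define f where "f = (\<lambda>x. \<Sum>p\<in>?P \<times> ?P. co p * fourier_char d (g p) x)"
  have f_eq: "f x = D x * T x" for x
    unfolding f_def D_def T_def sum_product sum.cartesian_product
    by (intro sum.cong refl) (auto simp: co_def g_def fourier_char_diff mult_ac simp del: One_nat_def)
  have g: "g ` (?P \<times> ?P) \<subseteq> frequencies d"
    by (auto simp: g_def frequencies_def)
  have coeff: "fourier_coeff d f k = (\<Sum>p | p \<in> ?P \<times> ?P \<and> g p = k. co p)" if "k \<in> frequencies d" for k
    unfolding f_def by (rule fourier_coeff_trig_poly[OF _ g that]) simp

  have coeff_le: "norm (fourier_coeff d f k) \<le> 1" if k: "k \<in> frequencies d" for k
  proof -
    let ?Q = "{p. p \<in> ?P \<times> ?P \<and> g p = k}"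
    \<comment> \<open>for given \<open>k\<close>, the set \<open>L\<close> determines \<open>S\<close>: each \<open>L\<close> contributes one coefficient of \<open>T\<close>\<close>
    have inj: "inj_on fst ?Q"
    proof (rule inj_onI)
      fix p q assume p: "p \<in> ?Q" and q: "q \<in> ?Q" and eq: "fst p = fst q"
      have "freq_of_set d (snd p) j = freq_of_set d (snd q) j" if "j \<in> {1..d}" for j
      proof -
        have "g p j = g q j" using p q by simp
        thus ?thesis using that eq by (simp add: g_def split_beta del: One_nat_def)
      qed
      hence "snd p = snd q"
        using p q by (intro freq_of_set_inject[of "snd p" d "snd q"]) (auto simp del: One_nat_def)
      thus "p = q" using eq by (simp add: prod_eq_iff)
    qed
    have "norm (fourier_coeff d f k) \<le> (\<Sum>p\<in>?Q. norm (co p))"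
      unfolding coeff[OF k] by (rule norm_sum)
    also have "\<dots> \<le> (\<Sum>p\<in>?Q. norm (u (?ty (fst p))))"
    proof (rule sum_mono)
      fix p assume "p \<in> ?Q"
      hence "norm (a (?ty (snd p))) \<le> 1" by (intro a_le) auto
      thus "norm (co p) \<le> norm (u (?ty (fst p)))"
        by (simp add: co_def split_beta norm_mult mult_left_le)
    qed
    also have "\<dots> = (\<Sum>L\<in>fst ` ?Q. norm (u (?ty L)))"
      using inj by (simp add: sum.reindex)
    also have "\<dots> \<le> (\<Sum>L\<in>?P. norm (u (?ty L)))"
      by (intro sum_mono2) auto
    also have "\<dots> = 1"
      using sum_u[of "\<lambda>z _. norm z"] Orb by (simp add: norm_divide)
    finally show ?thesis .
  qed

  have weighted_le:
    "norm (fourier_coeff d f k) * (\<Prod>m = 1..d. max 1 \<bar>real_of_int (k m)\<bar>) powr \<alpha> \<le> 1"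
    if k: "k \<in> frequencies d" for k
  proof (cases "\<exists>p\<in>?P \<times> ?P. g p = k")
    case True
    hence "max 1 \<bar>real_of_int (k m)\<bar> = 1" if "m \<in> {1..d}" for m
      using that by (auto simp: g_def freq_of_set_def)
    hence "(\<Prod>m = 1..d. max 1 \<bar>real_of_int (k m)\<bar>) = 1"
      by (intro prod.neutral) blast
    thus ?thesis using coeff_le[OF k] by simp
  next
    case False
    hence none: "{p. p \<in> ?P \<times> ?P \<and> g p = k} = {}" by blast
    show ?thesis unfolding coeff[OF k] none by simp
  qed

  have "f \<in> korobov d \<alpha>" "korobov_norm d \<alpha> f \<le> 1"
    using trig_poly_in_korobov[of "?P \<times> ?P" g d co \<alpha>] g weighted_le by (simp_all add: f_def)
  moreover have "f x = f (\<lambda>m\<in>{1..d}. x (\<sigma> m))" if \<sigma>: "\<sigma> \<in> perms_on d I" for \<sigma> x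
  proof -
    have "T (\<lambda>m\<in>{1..d}. x (\<sigma> m)) = T x"
      using sum_over_types_perm_invariant[OF \<sigma> I, of a "\<lambda>r. exp (2 * of_real pi * \<i> * of_real r)" x]
      by (simp only: T_def fourier_char_def)
    moreover have "D (\<lambda>m\<in>{1..d}. x (\<sigma> m)) = D x"
      using sum_over_types_perm_invariant[OF \<sigma> I, of u "\<lambda>r. exp (2 * of_real pi * \<i> * of_real (- r))" x]
      by (simp only: D_def fourier_char_def dot_def sum_negf of_int_minus mult_minus_left)
    ultimately show ?thesis by (simp only: f_eq)
  qed
  moreover have "Int_cube d f = 1"
  proof -
    have z: "(\<lambda>j\<in>{1..d}. 0) \<in> frequencies d" by (simp add: frequencies_def)
    have "g (L, S) = (\<lambda>j\<in>{1..d}. 0) \<longleftrightarrow> S = L" if "S \<in> ?P" "L \<in> ?P" for S L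
    proof
      assume "g (L, S) = (\<lambda>j\<in>{1..d}. 0)"
      hence "g (L, S) j = 0" if "j \<in> {1..d}" for j using that by simp
      hence "freq_of_set d S j = freq_of_set d L j" if "j \<in> {1..d}" for j
        using that by (simp add: g_def)
      thus "S = L" using \<open>S \<in> ?P\<close> \<open>L \<in> ?P\<close> by (intro freq_of_set_inject[of S d L]) auto
    qed (simp add: g_def)
    hence "{p. p \<in> ?P \<times> ?P \<and> g p = (\<lambda>j\<in>{1..d}. 0)} = (\<lambda>L. (L, L)) ` ?P"
      by (auto simp del: One_nat_def)
    hence "Int_cube d f = (\<Sum>L\<in>?P. u (?ty L) * a (?ty L))"
      unfolding Int_cube_eq_fourier_coeff coeff[OF z]
      by (simp add: sum.reindex inj_on_def co_def)
    also have "\<dots> = a (?ty S0)"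
      using sum_u[of "\<lambda>z j. z * a j"] Orb by simp
    also have "\<dots> = 1"
      using \<open>M > 0\<close> S0 by (simp add: a_def)
    finally show ?thesis .
  qed
  moreover have "f (t n) = 0" if n: "n \<in> {1..N}" for n
  proof -
    have "(\<Sum>S\<in>?P. c (?ty S) * ?e S (t n)) =
            (\<Sum>j\<in>?ty ` ?P. \<Sum>S | S \<in> ?P \<and> ?ty S = j. c (?ty S) * ?e S (t n))"
      by (intro sum.image_gen) simp
    also have "\<dots> = (\<Sum>j\<in>?ty ` ?P. (\<Sum>S | S \<in> ?P \<and> ?ty S = j. ?e S (t n)) * c j)"
      unfolding sum_distrib_right by (intro sum.cong refl) auto
    also have "\<dots> = 0" using c_sol n by blast
    finally have "(\<Sum>S\<in>?P. c (?ty S) * ?e S (t n)) / c (?ty S0) = 0" by simp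
    hence "T (t n) = 0" unfolding T_def a_def sum_divide_distrib by simp
    thus ?thesis by (simp add: f_eq)
  qed
  ultimately show ?thesis
    unfolding perm_inv_korobov_def by (intro bexI[of _ f] conjI CollectI ballI) blast+
qed

text \<open>
  A rule that sees only zeros returns \<open>0\<close>, while the fooling function has integral \<open>1\<close>.
\<close>

lemma one_le_min_error:
  assumes "I d \<subseteq> {1..d}" "N < 2 ^ (d - card (I d)) * (card (I d) + 1)"
  shows "1 \<le> min_error \<alpha> I N d"
  unfolding min_error_def
proof (rule INF_greatest)
  fix A assume "A \<in> cubature_rules N d"
  then obtain w t where A: "A = (\<lambda>f. \<Sum>n = 1..N. w n * f (t n))"
    by (auto simp: cubature_rules_def)
  obtain f where f: "f \<in> perm_inv_korobov d (I d) \<alpha>" "korobov_norm d \<alpha> f \<le> 1"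
      "Int_cube d f = 1" "\<forall>n\<in>{1..N}. f (t n) = 0"
    using fooling_function[OF assms, of \<alpha> t] by blast
  have "A f = 0" using f(4) by (simp add: A)
  thus "1 \<le> (SUP f\<in>{f \<in> perm_inv_korobov d (I d) \<alpha>. korobov_norm d \<alpha> f \<le> 1}.
               ennreal (norm (Int_cube d f - A f)))"
    using f by (intro SUP_upper2[of f]) auto
qed


section \<open>Convergence of grid means\<close>

definition korobov_weight :: "nat \<Rightarrow> real \<Rightarrow> (nat \<Rightarrow> int) \<Rightarrow> real" where
  "korobov_weight d \<alpha> k = (\<Prod>m = 1..d. max 1 \<bar>real_of_int (k m)\<bar>) powr (- \<alpha>)"

lemma norm_fourier_coeff_le_weight:
  assumes "korobov_norm d \<alpha> f \<le> 1" "k \<in> frequencies d"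
  shows "norm (fourier_coeff d f k) \<le> korobov_weight d \<alpha> k"
proof -
  let ?P = "\<Prod>m = 1..d. max 1 \<bar>real_of_int (k m)\<bar>"
  have "ennreal (norm (fourier_coeff d f k) * ?P powr \<alpha>) \<le> korobov_norm d \<alpha> f"
    unfolding korobov_norm_def by (rule SUP_upper[OF assms(2)])
  hence "ennreal (norm (fourier_coeff d f k) * ?P powr \<alpha>) \<le> ennreal 1"
    unfolding ennreal_1 using assms(1) by (rule order.trans)
  hence "norm (fourier_coeff d f k) * ?P powr \<alpha> \<le> 1"
    by (subst (asm) ennreal_le_iff) auto
  moreover have "?P > 0" by (intro prod_pos) auto
  hence "?P powr \<alpha> > 0" by (metis powr_gt_zero less_irrefl)
  ultimately show ?thesis by (simp only: korobov_weight_def powr_minus_divide pos_le_divide_eq)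
qed

lemma summable_on_max_abs_powr:
  assumes "\<alpha> > (1 :: real)"
  shows "(\<lambda>k :: int. max 1 \<bar>real_of_int k\<bar> powr (- \<alpha>)) summable_on UNIV"
proof -
  let ?w = "\<lambda>k :: int. max 1 \<bar>real_of_int k\<bar> powr (- \<alpha>)"
  have "summable (\<lambda>n. max 1 (real (Suc n)) powr (- \<alpha>))"
    using assms summable_real_powr_iff[of "- \<alpha>"] summable_Suc_iff[of "\<lambda>n. real n powr (- \<alpha>)"]
    by simp
  hence "summable (\<lambda>n. max 1 (real n) powr (- \<alpha>))"
    by (subst (asm) summable_Suc_iff)
  hence nat: "(\<lambda>n. max 1 (real n) powr (- \<alpha>)) summable_on UNIV"
    by (intro norm_summable_imp_summable_on) simp
  have "?w summable_on range int" "?w summable_on range (\<lambda>n. - int n)"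
    using nat by (subst summable_on_reindex; simp add: o_def inj_on_def)+
  hence "?w summable_on (range int \<union> range (\<lambda>n. - int n))"
    by (rule summable_on_union)
  moreover have "range int \<union> range (\<lambda>n. - int n) = UNIV"
  proof -
    have "k \<in> range int \<union> range (\<lambda>n. - int n)" for k
      by (cases k rule: int_cases2) auto
    thus ?thesis by blast
  qed
  ultimately show ?thesis by simp
qed

text \<open>
  Over a box of frequencies the sum factorises into \<open>d\<close> one-dimensional sums, each of which
  converges as \<open>\<alpha> > 1\<close>; every finite set of frequencies lies in a box.
\<close>

lemma summable_on_korobov_weight:
  assumes "\<alpha> > 1"
  shows "korobov_weight d \<alpha> summable_on frequencies d"
proof (rule nonneg_bdd_above_summable_on)
  let ?w = "\<lambda>k :: int. max 1 \<bar>real_of_int k\<bar> powr (- \<alpha>)"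
  have weight_eq: "korobov_weight d \<alpha> k = (\<Prod>m = 1..d. ?w (k m))" for k
    unfolding korobov_weight_def by (rule prod_powr_distrib)
  have "sum (korobov_weight d \<alpha>) F \<le> infsum ?w UNIV ^ d" if F: "F \<subseteq> frequencies d" "finite F" for F
  proof -
    let ?B = "\<lambda>m. (\<lambda>k. k m) ` F"
    have "F \<subseteq> PiE {1..d} ?B" using F by (auto simp: frequencies_def PiE_def)
    hence "sum (korobov_weight d \<alpha>) F \<le> (\<Sum>k\<in>PiE {1..d} ?B. \<Prod>m = 1..d. ?w (k m))"
      unfolding weight_eq using F by (intro sum_mono2 finite_PiE prod_nonneg) auto
    also have "\<dots> = (\<Prod>m = 1..d. \<Sum>z\<in>?B m. ?w z)"
      using F by (subst prod_sum_PiE) auto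
    also have "\<dots> \<le> (\<Prod>m = 1..d. infsum ?w UNIV)"
      using F summable_on_max_abs_powr[OF assms]
      by (intro prod_mono) (auto intro!: sum_nonneg finite_sum_le_infsum)
    finally show ?thesis by simp
  qed
  thus "bdd_above (sum (korobov_weight d \<alpha>) ` {F. F \<subseteq> frequencies d \<and> finite F})"
    by (intro bdd_aboveI2[where M = "infsum ?w UNIV ^ d"]) auto
qed (simp add: korobov_weight_def)

definition grid_point :: "nat \<Rightarrow> nat \<Rightarrow> (nat \<Rightarrow> nat) \<Rightarrow> nat \<Rightarrow> real" where
  "grid_point d m y = (\<lambda>j\<in>{1..d}. real (y j) / real m)"

definition grid_mean :: "nat \<Rightarrow> nat \<Rightarrow> ((nat \<Rightarrow> real) \<Rightarrow> complex) \<Rightarrow> complex" where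
  "grid_mean d m f = (\<Sum>y\<in>PiE {1..d} (\<lambda>_. {..<m}). 1 / of_nat m ^ d * f (grid_point d m y))"

lemma grid_point_in_cube:
  assumes "y \<in> PiE {1..d} (\<lambda>_. {..<m})"
  shows "grid_point d m y \<in> cube d"
  unfolding cube_def grid_point_def
proof (rule restrict_PiE_iff[THEN iffD2], intro ballI)
  fix j assume "j \<in> {1..d}"
  hence "y j < m" using assms by (auto simp: PiE_iff)
  thus "real (y j) / real m \<in> {0..1}" by (simp add: divide_le_eq)
qed

lemma grid_mean_in_cubature_rules: "grid_mean d m \<in> cubature_rules (m ^ d) d"
proof -
  let ?Y = "PiE {1..d} (\<lambda>_. {..<m})"
  have "card ?Y = m ^ d" by (subst card_PiE) auto
  then obtain h where h: "bij_betw h {1..m ^ d} ?Y"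
    using ex_bij_betw_nat_finite_1[of ?Y] by (auto intro: finite_PiE)
  have "grid_mean d m = (\<lambda>f. \<Sum>n = 1..m ^ d. 1 / of_nat m ^ d * f (grid_point d m (h n)))"
    unfolding grid_mean_def by (intro ext sum.reindex_bij_betw[OF h, symmetric])
  moreover have "grid_point d m (h n) \<in> cube d" if "n \<in> {1..m ^ d}" for n
    using h that by (intro grid_point_in_cube bij_betw_apply[OF h])
  ultimately show ?thesis
    unfolding cubature_rules_def
    by (intro CollectI exI[of _ "\<lambda>_. 1 / of_nat m ^ d"] exI[of _ "\<lambda>n. grid_point d m (h n)"]) auto
qed

lemma grid_mean_fourier_char:
  "grid_mean d m (fourier_char d k) =
     (\<Prod>j\<in>{1..d}. (\<Sum>i<m. exp (2 * of_real pi * \<i> * of_int (k j) * of_real (real i / real m))) / of_nat m)"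
proof -
  have "grid_mean d m (fourier_char d k) = 1 / of_nat m ^ d * (\<Sum>y\<in>PiE {1..d} (\<lambda>_. {..<m}).
      \<Prod>j\<in>{1..d}. exp (2 * of_real pi * \<i> * of_int (k j) * of_real (real (y j) / real m)))"
    unfolding grid_mean_def sum_distrib_left
    by (intro sum.cong refl arg_cong2[where f = "(*)"])
       (simp add: fourier_char_conv_prod grid_point_def)
  thus ?thesis by (subst (asm) prod_sum_PiE[symmetric]) (auto simp: prod_dividef)
qed

lemma sum_exp_grid_eq_0:
  fixes k :: int
  assumes "k \<noteq> 0" "\<bar>k\<bar> < int m"
  shows "(\<Sum>i<m. exp (2 * of_real pi * \<i> * of_int k * of_real (real i / real m))) = 0"
proof -
  define z where "z = exp (2 * of_real pi * \<i> * of_int k / of_nat m)"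
  have m: "m > 0" using assms by auto
  have "z ^ m = exp (2 * of_real pi * \<i> * of_int k)"
    using m by (simp add: z_def flip: exp_of_nat_mult)
  also have "\<dots> = 1" by (simp add: exp_eq_1)
  finally have "z ^ m = 1" .
  have "z \<noteq> 1"
  proof
    assume "z = 1"
    then obtain n :: int where "2 * pi * of_int k / real m = of_int (2 * n) * pi"
      unfolding z_def exp_eq_1 by auto
    hence "real_of_int k = real_of_int (n * int m)" using m by (simp add: field_simps)
    hence "k = n * int m" by linarith
    hence "int m dvd k" by simp
    thus False using assms zdvd_not_zless[of "\<bar>k\<bar>" "int m"] by simp
  qed
  have "(\<Sum>i<m. exp (2 * of_real pi * \<i> * of_int k * of_real (real i / real m))) = (\<Sum>i<m. z ^ i)"
    by (intro sum.cong refl) (simp add: z_def mult_ac flip: exp_of_nat_mult)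
  also have "\<dots> = 0"
    using \<open>z \<noteq> 1\<close> \<open>z ^ m = 1\<close> by (simp add: sum_gp_strict)
  finally show ?thesis .
qed

lemma has_sum_sum_finite:
  fixes g :: "'i \<Rightarrow> 'k \<Rightarrow> 'a :: topological_comm_monoid_add"
  assumes "finite Y" "\<And>y. y \<in> Y \<Longrightarrow> (g y has_sum s y) A"
  shows "((\<lambda>k. \<Sum>y\<in>Y. g y k) has_sum (\<Sum>y\<in>Y. s y)) A"
  using assms by (induction Y rule: finite_induct) (auto intro!: has_sum_add)

lemma has_sum_diff:
  fixes f g :: "'k \<Rightarrow> 'a :: topological_ab_group_add"
  assumes "(f has_sum a) A" "(g has_sum b) A"
  shows "((\<lambda>k. f k - g k) has_sum (a - b)) A"
  using has_sum_add[of f A a "\<lambda>k. - g k" "- b"] assms by (simp add: has_sum_uminus)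

text \<open>
  The mean over the grid may be taken termwise in the Fourier series, so the error of the rule is
  a linear combination of its errors on the characters.
\<close>

lemma grid_mean_error_has_sum:
  assumes f: "f \<in> korobov d \<alpha>"
  shows "((\<lambda>k. fourier_coeff d f k * (of_bool (k = (\<lambda>j\<in>{1..d}. 0)) - grid_mean d m (fourier_char d k)))
            has_sum (Int_cube d f - grid_mean d m f)) (frequencies d)"
proof -
  let ?Y = "PiE {1..d} (\<lambda>_. {..<m})" and ?z = "\<lambda>j\<in>{1..d}. 0 :: int"
  have "((\<lambda>k. \<Sum>y\<in>?Y. 1 / of_nat m ^ d * (fourier_coeff d f k * fourier_char d k (grid_point d m y)))
           has_sum grid_mean d m f) (frequencies d)"
    unfolding grid_mean_def
  proof (intro has_sum_sum_finite has_sum_cmult_right)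
    fix y assume "y \<in> ?Y"
    hence "grid_point d m y \<in> cube d" by (rule grid_point_in_cube)
    thus "((\<lambda>k. fourier_coeff d f k * fourier_char d k (grid_point d m y))
             has_sum f (grid_point d m y)) (frequencies d)"
      using f by (simp add: korobov_def fourier_char_def)
  qed (auto intro: finite_PiE)
  moreover have "(\<Sum>y\<in>?Y. 1 / of_nat m ^ d * (fourier_coeff d f k * fourier_char d k (grid_point d m y)))
      = fourier_coeff d f k * grid_mean d m (fourier_char d k)" for k
    by (simp add: grid_mean_def sum_distrib_left mult_ac)
  ultimately have 1: "((\<lambda>k. fourier_coeff d f k * grid_mean d m (fourier_char d k)) has_sum grid_mean d m f)
                     (frequencies d)" by simp
  have 2: "((\<lambda>k. fourier_coeff d f k * of_bool (k = ?z)) has_sum fourier_coeff d f ?z) (frequencies d)"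
    by (rule has_sum_finite_neutralI[of "{?z}"]) (auto simp: frequencies_def)
  show ?thesis
    using has_sum_diff[OF 2 1] by (simp add: Int_cube_eq_fourier_coeff right_diff_distrib)
qed

text \<open>
  Outside a finite set \<open>F\<close> the weights sum up to at most \<open>\<epsilon>\<close>. A grid with more points per axis
  than any entry of a frequency in \<open>F\<close> integrates the characters in \<open>F\<close> exactly; all other
  characters have an error of at most \<open>1\<close>, and coefficients bounded by the weights. No rate is
  sought: the lemma serves to make the minimum in the information complexity exist.
\<close>

lemma exists_cubature_rule_with_small_error:
  assumes \<alpha>: "\<alpha> > 1" and \<epsilon>: "\<epsilon> > 0"
  shows "\<exists>N. min_error \<alpha> I N d \<le> ennreal \<epsilon>"
proof -
  let ?w = "korobov_weight d \<alpha>"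
  have w: "?w summable_on frequencies d" by (rule summable_on_korobov_weight[OF \<alpha>])
  obtain F where F: "finite F" "F \<subseteq> frequencies d" "dist (sum ?w F) (infsum ?w (frequencies d)) \<le> \<epsilon>"
    using infsum_finite_approximation[OF w \<epsilon>] by blast
  have "finite ((\<lambda>(k, j). nat \<bar>k j\<bar>) ` (F \<times> {1..d}))" using F by auto
  then obtain m0 where m0: "\<forall>i\<in>(\<lambda>(k, j). nat \<bar>k j\<bar>) ` (F \<times> {1..d}). i < m0"
    unfolding finite_nat_set_iff_bounded by blast
  \<comment> \<open>the successor keeps \<open>m\<close> positive also if \<open>F\<close> is empty\<close>
  define m where "m = Suc m0"
  have m: "m > 0" by (simp add: m_def)
  have less_m: "\<bar>k j\<bar> < int m" if "k \<in> F" "j \<in> {1..d}" for k j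
  proof -
    have "nat \<bar>k j\<bar> < m0" using m0 that by (auto simp del: One_nat_def)
    thus ?thesis by (simp add: m_def)
  qed
  let ?R = "\<lambda>k. of_bool (k = (\<lambda>j\<in>{1..d}. 0)) - grid_mean d m (fourier_char d k)"
  have R_zero: "grid_mean d m (fourier_char d (\<lambda>j\<in>{1..d}. 0)) = 1"
    unfolding grid_mean_fourier_char using m by (intro prod.neutral) auto
  have R_F: "?R k = 0" if k: "k \<in> F" for k
  proof (cases "k = (\<lambda>j\<in>{1..d}. 0)")
    case False
    have "k \<in> {1..d} \<rightarrow>\<^sub>E UNIV" using k F by (auto simp: frequencies_def)
    hence "\<exists>j\<in>{1..d}. k j \<noteq> 0"
      using False PiE_ext[of k "{1..d}" "\<lambda>_. UNIV" "\<lambda>j\<in>{1..d}. 0"] by auto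
    then obtain j where j: "j \<in> {1..d}" "k j \<noteq> 0" by blast
    hence "(\<Sum>i<m. exp (2 * of_real pi * \<i> * of_int (k j) * of_real (real i / real m))) = 0"
      using less_m[OF k j(1)] by (intro sum_exp_grid_eq_0)
    thus ?thesis using False j unfolding grid_mean_fourier_char by (simp add: prod_zero_iff bexI[of _ j])
  qed (simp add: R_zero del: One_nat_def)
  have R_le: "norm (?R k) \<le> 1" for k
  proof (cases "k = (\<lambda>j\<in>{1..d}. 0)")
    case False
    have "norm (\<Sum>i<m. exp (2 * of_real pi * \<i> * of_int (k j) * of_real (real i / real m))) \<le> real m" for j
      by (rule order_trans[OF norm_sum]) simp
    hence "norm (grid_mean d m (fourier_char d k)) \<le> (\<Prod>j\<in>{1..d}. 1)"
      unfolding grid_mean_fourier_char prod_norm[symmetric] using m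
      by (intro prod_mono) (auto simp: norm_divide)
    thus ?thesis using False by simp
  qed (simp add: R_zero del: One_nat_def)
  have "(?w has_sum infsum ?w (frequencies d)) (frequencies d)"
    using w by (rule has_sum_infsum)
  moreover have "((\<lambda>k. if k \<in> F then ?w k else 0) has_sum sum ?w F) (frequencies d)"
    by (rule has_sum_finite_neutralI[of F]) (use F in auto)
  ultimately have tail:
    "((\<lambda>k. ?w k - (if k \<in> F then ?w k else 0)) has_sum (infsum ?w (frequencies d) - sum ?w F)) (frequencies d)"
    by (rule has_sum_diff)
  have "norm (Int_cube d f - grid_mean d m f) \<le> \<epsilon>"
    if f: "f \<in> perm_inv_korobov d (I d) \<alpha>" "korobov_norm d \<alpha> f \<le> 1" for f
  proof -
    have "f \<in> korobov d \<alpha>" using f by (simp add: perm_inv_korobov_def)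
    hence "norm (Int_cube d f - grid_mean d m f) \<le> infsum ?w (frequencies d) - sum ?w F"
    proof (rule norm_infsum_le[OF grid_mean_error_has_sum tail])
      fix k assume k: "k \<in> frequencies d"
      show "norm (fourier_coeff d f k * ?R k) \<le> ?w k - (if k \<in> F then ?w k else 0)"
      proof (cases "k \<in> F")
        case False
        have "norm (fourier_coeff d f k) * norm (?R k) \<le> ?w k * 1"
          using norm_fourier_coeff_le_weight[OF f(2) k] R_le
          by (intro mult_mono) (auto simp: korobov_weight_def)
        thus ?thesis using False by (simp add: norm_mult)
      qed (simp only: R_F; simp)
    qed
    thus ?thesis using F(3) by (simp add: dist_real_def)
  qed
  hence "min_error \<alpha> I (m ^ d) d \<le> ennreal \<epsilon>"
    unfolding min_error_def
    by (intro INF_lower2[OF grid_mean_in_cubature_rules] SUP_least ennreal_leI) auto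
  thus ?thesis by blast
qed


section \<open>The information complexity and its growth\<close>

text \<open>
  The information complexity is a least number, about which the lower error bound says something
  only because some number of points does reach the error \<open>\<epsilon>\<close>.
\<close>

lemma info_complexity_lower_bound:
  assumes \<alpha>: "\<alpha> > 1" and I: "I d \<subseteq> {1..d}" and \<epsilon>: "0 < \<epsilon>" "\<epsilon> < 1"
  shows "2 ^ (d - card (I d)) * (card (I d) + 1) \<le> info_complexity \<alpha> I \<epsilon> d"
proof (rule ccontr)
  assume "\<not> ?thesis"
  hence "1 \<le> min_error \<alpha> I (info_complexity \<alpha> I \<epsilon> d) d"
    using I by (intro one_le_min_error) auto
  also have "\<dots> \<le> ennreal \<epsilon>"
    unfolding info_complexity_def
    by (rule LeastI_ex[OF exists_cubature_rule_with_small_error[OF \<alpha> \<epsilon>(1)]])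
  also have "\<dots> < 1" using \<epsilon> by (simp add: ennreal_less_one_iff)
  finally show False by simp
qed

lemma Suc_le_two_power_times:
  fixes a b :: nat
  shows "a + b + 1 \<le> 2 ^ b * (a + 1)"
proof -
  have "b + 1 \<le> 2 ^ b" by (induction b) auto
  hence "(b + 1) * (a + 1) \<le> 2 ^ b * (a + 1)" by (rule mult_right_mono) simp
  thus ?thesis by simp
qed

lemma polynomial_growth_exponent_ge_1:
  assumes "\<And>d. d \<ge> 1 \<Longrightarrow> real (d + 1) \<le> K * real d powr q"
  shows "q \<ge> 1"
proof (rule ccontr)
  assume "\<not> q \<ge> 1"
  hence "((\<lambda>d. real d powr (q - 1)) \<longlongrightarrow> 0) sequentially"
    by (intro tendsto_neg_powr filterlim_real_sequentially) auto
  hence "((\<lambda>d. K * real d powr (q - 1)) \<longlongrightarrow> K * 0) sequentially"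
    by (intro tendsto_mult tendsto_const)
  hence "eventually (\<lambda>d. K * real d powr (q - 1) < 1) sequentially"
    by (intro order_tendstoD(2)[of _ "K * 0"]) auto
  moreover have "1 \<le> K * real d powr (q - 1)" if "d \<ge> 1" for d
  proof -
    have "real d \<le> K * real d powr q" using assms[OF that] by simp
    thus ?thesis using that by (simp add: powr_diff field_simps)
  qed
  ultimately have "eventually (\<lambda>d. False) sequentially"
    by (smt (verit) eventually_at_top_linorder le_cases not_less)
  thus False by simp
qed

text \<open>
  The tractability statements depend on the integration problem only through the lower bound
  below. Here \<open>a d\<close> is the number of permutable coordinates, \<open>b d\<close> that of the remaining ones.
\<close>

locale exponential_information_bound =
  fixes n :: "real \<Rightarrow> nat \<Rightarrow> nat" and a b :: "nat \<Rightarrow> nat"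
  assumes lower: "\<And>\<epsilon> d. 0 < \<epsilon> \<Longrightarrow> \<epsilon> < 1 \<Longrightarrow> d \<ge> 1 \<Longrightarrow> 2 ^ b d * (a d + 1) \<le> n \<epsilon> d"
    and dim: "\<And>d. d \<ge> 1 \<Longrightarrow> a d + b d = d"
begin

lemma two_power_le: "real (2 ^ b d) \<le> real (n \<epsilon> d)" if "0 < \<epsilon>" "\<epsilon> < 1" "d \<ge> 1"
proof -
  have "2 ^ b d \<le> 2 ^ b d * (a d + 1)" by simp
  thus ?thesis using lower[OF that] by (meson le_trans of_nat_mono)
qed

lemma ln_lower: "real (b d) * ln 2 \<le> ln (real (n \<epsilon> d))" if "0 < \<epsilon>" "\<epsilon> < 1" "d \<ge> 1"
proof -
  have "real (b d) * ln 2 = ln (real (2 ^ b d))" by (simp add: ln_realpow)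
  also have "\<dots> \<le> ln (real (n \<epsilon> d))"
    using two_power_le[OF that] by (intro ln_mono) auto
  finally show ?thesis .
qed

text \<open>
  Already at \<open>\<epsilon> = 1/2\<close>, polynomial growth in \<open>d\<close> must dominate \<open>d + 1\<close>, which gives
  \<open>q \<ge> 1\<close>, and \<open>2\<^sup>b\<close>, which gives the logarithmic bound.
\<close>

lemma polynomially_tractable_imp:
  assumes "polynomially_tractable_with n C p q"
  shows "q \<ge> 1" "(\<lambda>d. real (b d)) \<in> O(\<lambda>d. ln (real d))"
proof -
  define K where "K = C * (1 / 2) powr (- p)"
  have C: "C > 0" using assms by (auto simp: polynomially_tractable_with_def)
  have K: "K > 0" using C by (simp add: K_def)
  have upper: "real (n (1 / 2) d) \<le> K * real d powr q" if "d \<ge> 1" for d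
    using assms that by (auto simp: polynomially_tractable_with_def K_def)
  show "q \<ge> 1"
  proof (rule polynomial_growth_exponent_ge_1)
    fix d :: nat assume d: "d \<ge> 1"
    have "d + 1 \<le> n (1 / 2) d"
      using lower[of "1 / 2" d] Suc_le_two_power_times[of "a d" "b d"] dim[OF d] d by simp
    hence "real (d + 1) \<le> real (n (1 / 2) d)" by (simp only: of_nat_le_iff)
    also note upper[OF d]
    finally show "real (d + 1) \<le> K * real d powr q" .
  qed
  show "(\<lambda>d. real (b d)) \<in> O(\<lambda>d. ln (real d))"
  proof (rule bigoI[where c = "(\<bar>ln K\<bar> + q) / ln 2"])
    \<comment> \<open>from \<open>d = 3 > exp 1\<close> on, the constant \<open>\<bar>ln K\<bar>\<close> is at most \<open>\<bar>ln K\<bar> * ln d\<close>\<close>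
    have "eventually (\<lambda>d. d \<ge> 3) sequentially" by (rule eventually_ge_at_top)
    thus "eventually (\<lambda>d. norm (real (b d)) \<le> (\<bar>ln K\<bar> + q) / ln 2 * norm (ln (real d))) sequentially"
    proof eventually_elim
      case (elim d)
      hence "exp 1 \<le> real d" using exp_le by linarith
      hence ln_d: "1 \<le> ln (real d)" using elim by (subst ln_ge_iff) auto
      have "1 \<le> real (n (1 / 2) d)"
        using two_power_le[of "1 / 2" d] elim by (intro order_trans[OF _ two_power_le]) auto
      hence "ln (real (n (1 / 2) d)) \<le> ln (K * real d powr q)"
        using upper[of d] elim by (intro ln_mono) auto
      also have "\<dots> = ln K + q * ln (real d)"
        using K elim by (simp add: ln_mult ln_powr)
      also have "\<dots> \<le> \<bar>ln K\<bar> * ln (real d) + q * ln (real d)"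
        using mult_left_mono[OF ln_d, of "\<bar>ln K\<bar>"] by simp
      finally have "real (b d) * ln 2 \<le> (\<bar>ln K\<bar> + q) * ln (real d)"
        using ln_lower[of "1 / 2" d] elim by (simp add: distrib_right)
      thus ?case using ln_d by (simp add: field_simps)
    qed
  qed
qed

text \<open>
  Along \<open>\<epsilon> = 1/2\<close> and \<open>d \<rightarrow> \<infinity>\<close> the quantity \<open>\<epsilon>\<^sup>-\<^sup>s\<close> is a constant \<open>K\<close>, which costs no more than the
  factor \<open>K + 1\<close> in front of \<open>d\<^sup>t\<close>.
\<close>

lemma weakly_tractable_st_imp:
  assumes t: "t > 0" and wt: "weakly_tractable_st s t n"
  shows "(\<lambda>d. real (b d)) \<in> o(\<lambda>d. real d powr t)"
proof -
  have "filterlim (\<lambda>d. (1 / 2 :: real, d)) inv_eps_plus_dim_at_top sequentially"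
    unfolding inv_eps_plus_dim_at_top_def filterlim_inf filterlim_filtercomap_iff filterlim_principal
  proof
    show "filterlim ((\<lambda>(\<epsilon>, d). 1 / \<epsilon> + real d) \<circ> (\<lambda>d. (1 / 2 :: real, d))) at_top sequentially"
      by (simp add: o_def filterlim_tendsto_add_at_top[OF tendsto_const filterlim_real_sequentially])
    show "eventually (\<lambda>d. (1 / 2 :: real, d) \<in> {0<..1} \<times> {1..}) sequentially"
      using eventually_ge_at_top[of 1] by eventually_elim simp
  qed
  from filterlim_compose[OF wt[unfolded weakly_tractable_st_def] this]
  have lim: "((\<lambda>d. ln (real (n (1 / 2) d)) / ((1 / 2) powr (- s) + real d powr t)) \<longlongrightarrow> 0) sequentially"
    by simp
  define K where "K = (1 / 2 :: real) powr (- s)"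
  have K: "K > 0" by (simp add: K_def)
  show ?thesis
  proof (rule landau_o.smallI)
    fix c :: real assume c: "c > 0"
    define c' where "c' = c * ln 2 / (K + 1)"
    have "c' > 0" using c K by (simp add: c'_def)
    hence "eventually (\<lambda>d. ln (real (n (1 / 2) d)) / (K + real d powr t) < c') sequentially"
      using lim unfolding K_def by (intro order_tendstoD(2)[of _ 0])
    moreover have "eventually (\<lambda>d. d \<ge> 1) sequentially" by (rule eventually_ge_at_top)
    ultimately show "eventually (\<lambda>d. norm (real (b d)) \<le> c * norm (real d powr t)) sequentially"
    proof eventually_elim
      case (elim d)
      have "1 \<le> real d powr t" using elim t by (intro ge_one_powr_ge_zero) auto
      hence le: "K + real d powr t \<le> (K + 1) * real d powr t"
        using K by (simp add: distrib_right)
      have "K + real d powr t > 0" using K by (intro add_pos_nonneg) auto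
      hence "ln (real (n (1 / 2) d)) \<le> c' * (K + real d powr t)"
        using elim by (simp add: pos_divide_less_eq)
      also have "\<dots> \<le> c' * ((K + 1) * real d powr t)"
        using le \<open>c' > 0\<close> by (intro mult_left_mono) auto
      also have "\<dots> = c * real d powr t * ln 2" using K by (simp add: c'_def)
      finally have "real (b d) * ln 2 \<le> (c * real d powr t) * ln 2"
        using ln_lower[of "1 / 2" d] elim by linarith
      hence "real (b d) \<le> c * real d powr t" by (rule mult_right_le_imp_le) simp
      thus ?case by simp
    qed
  qed
qed

text \<open>
  If \<open>b d > \<delta> d\<close> for infinitely many \<open>d\<close>, then \<open>2\<^sup>b\<close> exceeds \<open>(2\<^sup>\<delta>)\<^sup>d\<close> for these \<open>d\<close>.
\<close>

lemma curse_if_not_smallo: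
  assumes "(\<lambda>d. real (b d)) \<notin> o(\<lambda>d. real d)"
  shows "curse_of_dimensionality n"
proof -
  obtain \<delta> where \<delta>: "\<delta> > 0" "\<not> eventually (\<lambda>d. real (b d) \<le> \<delta> * real d) sequentially"
    using assms by (auto simp: smallo_def)
  have "frequently (\<lambda>d. \<delta> * real d < real (b d)) sequentially"
    using \<delta>(2) by (simp add: frequently_def not_less)
  hence "frequently (\<lambda>d. \<delta> * real d < real (b d) \<and> d \<ge> 1) sequentially"
    by (rule frequently_eventually_frequently) (rule eventually_ge_at_top)
  hence inf: "infinite {d. \<delta> * real d < real (b d) \<and> d \<ge> 1}"
    by (simp add: frequently_cofinite flip: cofinite_eq_sequentially)
  have "(1 + (2 powr \<delta> - 1)) ^ d \<le> real (n \<epsilon> d)"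
    if "\<delta> * real d < real (b d)" "d \<ge> 1" "\<epsilon> \<in> {0<..1 / 2}" for d \<epsilon>
  proof -
    have "(1 + (2 powr \<delta> - 1)) ^ d = 2 powr (\<delta> * real d)"
      by (simp add: powr_powr flip: powr_realpow)
    also have "\<dots> \<le> 2 powr real (b d)" using that by (intro powr_mono) auto
    also have "\<dots> = real (2 ^ b d)" by (simp add: powr_realpow)
    also have "\<dots> \<le> real (n \<epsilon> d)" using that by (intro two_power_le) auto
    finally show ?thesis .
  qed
  hence "{d. \<delta> * real d < real (b d) \<and> d \<ge> 1} \<subseteq>
      {d. d \<ge> 1 \<and> (\<forall>\<epsilon>\<in>{0<..1 / 2}. real (n \<epsilon> d) \<ge> 1 * (1 + (2 powr \<delta> - 1)) ^ d)}"
    by auto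
  hence "infinite {d. d \<ge> 1 \<and> (\<forall>\<epsilon>\<in>{0<..1 / 2}. real (n \<epsilon> d) \<ge> 1 * (1 + (2 powr \<delta> - 1)) ^ d)}"
    using inf by (rule infinite_super)
  moreover have "2 powr \<delta> - 1 > 0" using \<delta> by simp
  ultimately show ?thesis
    unfolding curse_of_dimensionality_def
    by (intro exI[of _ 1] exI[of _ "1 / 2"] exI[of _ "2 powr \<delta> - 1"] conjI) auto
qed

end

theorem corollary1:
  fixes \<alpha> :: real and I :: "nat \<Rightarrow> nat set" and b :: "nat \<Rightarrow> nat"
    and n :: "real \<Rightarrow> nat \<Rightarrow> nat"
  assumes "\<alpha> > 1"
    and "\<And>d. d \<ge> 1 \<Longrightarrow> I d \<subseteq> {1..d}"
  defines "b \<equiv> \<lambda>d. d - card (I d)"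
    and "n \<equiv> info_complexity \<alpha> I"
  shows
    "((\<forall>C p q. polynomially_tractable_with n C p q \<longrightarrow>
          q \<ge> 1 \<and> (\<lambda>d. real (b d)) \<in> O(\<lambda>d. ln (real d))) \<and>
      \<not> strongly_polynomially_tractable n) \<and>
     (uniformly_weakly_tractable n \<longrightarrow>
        (\<forall>t\<in>{0<..1}. (\<lambda>d. real (b d)) \<in> o(\<lambda>d. real d powr t))) \<and>
     ((\<forall>s\<in>{0<..1}. \<forall>t\<in>{0<..1}. weakly_tractable_st s t n \<longrightarrow>
          (\<lambda>d. real (b d)) \<in> o(\<lambda>d. real d powr t)) \<and>
      (weakly_tractable n \<longrightarrow> (\<lambda>d. real (b d)) \<in> o(\<lambda>d. real d))) \<and>
     (((\<lambda>d. real (b d)) \<notin> o(\<lambda>d. real d) \<longrightarrow> curse_of_dimensionality n) \<and>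
      (\<not> curse_of_dimensionality n \<longrightarrow> (\<lambda>d. real (b d)) \<in> o(\<lambda>d. real d)))"
proof -
  interpret exponential_information_bound n "\<lambda>d. card (I d)" b
  proof
    show "2 ^ b d * (card (I d) + 1) \<le> n \<epsilon> d" if "0 < \<epsilon>" "\<epsilon> < 1" "d \<ge> 1" for \<epsilon> d
      unfolding b_def n_def using assms(1,2) that by (intro info_complexity_lower_bound)
    show "card (I d) + b d = d" if "d \<ge> 1" for d
      using card_mono[OF _ assms(2)[OF that]] by (simp add: b_def)
  qed
  have strong: "\<not> strongly_polynomially_tractable n"
    using polynomially_tractable_imp(1) by (fastforce simp: strongly_polynomially_tractable_def)
  have uniform: "(\<lambda>d. real (b d)) \<in> o(\<lambda>d. real d powr t)"
    if "uniformly_weakly_tractable n" "t \<in> {0<..1}" for t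
  proof (rule weakly_tractable_st_imp)
    show "weakly_tractable_st 1 t n" using that by (simp add: uniformly_weakly_tractable_def)
  qed (use that in simp)
  have weak: "(\<lambda>d. real (b d)) \<in> o(\<lambda>d. real d)" if "weakly_tractable n"
    using weakly_tractable_st_imp[of 1 1] that by (simp add: weakly_tractable_def)
  show ?thesis
    using polynomially_tractable_imp strong uniform weakly_tractable_st_imp weak curse_if_not_smallo
    by auto
qed

end
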